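(* Let $S$ be a finite relative simplicial complex equipped with a Morse tiling. Then the Morse tiling is shellable if and only if its quiver contains no oriented cycle.
   Context: Simplices are closed; an open simplex is the relative interior of a simplex. A finite relative simplicial complex is a complement $S=K\setminus L$, where $L$ is a (possibly empty) subcomplex of a finite simplicial complex $K$; it is regarded as the union of the open simplices of $K$ that are not in $L$, with the topology induced from (the geometric realization of) $K$. Thus a union of open simplices of $S$ is closed in $S$ iff it contains every open simplex of $S$ that is a face of one of its members. Morse tiles: a Morse tile $T$ of dimension $n\ge 0$ and order $k\in\{0,\dots,n+1\}$ is an $n$-simplex $\overline T$ (its underlying simplex) from which one removes $k$ of its (closed) codimension one faces together with one possibly empty (closed) face $\mu$ of codimension greater than one, called its Morse face; when $\mu$ is non-empty it is understood not to be contained in the removed codimension one faces. Morse tiling: a Morse tiling of $S$ is a partition of $S$ by Morse tiles (each tile $T\subset S$ having underlying simplex $\overline T\in K$) such that for every $j\ge 0$ the union of the tiles of dimension greater than $j$ is closed in $S$. Shellable: a Morse tiling of $S$ is shellable iff there is a filtration $\emptyset=S_0\subset S_1\subset\dots\subset S_N=S$ by closed subsets of $S$ such that for every $j\in\{1,\dots,N\}$, $S_j\setminus S_{j-1}$ is a single tile of the tiling. Quiver: a quiver is a finite directed graph. The quiver of a Morse tiling has the tiles as vertices and contains an arrow $T\to T'$, for tiles $T\ne T'$, iff $\overline T\cap T'\neq\emptyset$. A path is a sequence of arrows $(a_1,\dots,a_p)$ such that the target of $a_j$ is the source of $a_{j+1}$ for $1\le j<p$; an oriented cycle is a path of positive length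 $p\geq 1$ whose source and target coincide. *)

theory Defs
  imports "HOL-Analysis.Analysis" "Graph_Theory.Arc_Walk" "HOL-Library.Disjoint_Sets"
begin

(* Finite simplicial complexes are realized in a Euclidean space, as in HOL-Analysis; there the
   empty simplex is a face of every simplex. It has empty relative interior, so it contributes
   no point to the union below. *)
definition relative_complex ::
    "'a::euclidean_space set set \<Rightarrow> 'a set set \<Rightarrow> 'a set" where
  "relative_complex K L = (\<Union>\<sigma>\<in>K - L. rel_interior \<sigma>)"

(* morse_tile n k \<sigma> T: T is a Morse tile of dimension n and order k with underlying simplex \<sigma>;
   F is the set of removed codimension one faces and \<mu> the Morse face. The condition on faces in F
   is not "facet_of", which excludes the empty set: the codimension one face of a
   0-simplex is empty, so that a point is a tile of order 0 and also of order 1. *)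
definition morse_tile ::
    "nat \<Rightarrow> nat \<Rightarrow> 'a::euclidean_space set \<Rightarrow> 'a set \<Rightarrow> bool" where
  "morse_tile n k \<sigma> T \<longleftrightarrow>
     int n simplex \<sigma> \<and> k \<le> n + 1 \<and>
     (\<exists>F \<mu>. F \<subseteq> {f. f face_of \<sigma> \<and> aff_dim f = int n - 1} \<and> card F = k \<and>
            (\<mu> = {} \<or> \<mu> face_of \<sigma> \<and> aff_dim \<mu> < int n - 1 \<and> \<not> \<mu> \<subseteq> \<Union>F) \<and>
            T = \<sigma> - (\<Union>F \<union> \<mu>))"

definition is_morse_tile :: "'a::euclidean_space set \<Rightarrow> bool" where
  "is_morse_tile T \<longleftrightarrow> (\<exists>n k \<sigma>. morse_tile n k \<sigma> T)"

(* Well defined for Morse tiles, see underlying_simplex_eq. *)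
definition underlying_simplex :: "'a::euclidean_space set \<Rightarrow> 'a set" where
  "underlying_simplex T = (THE \<sigma>. \<exists>n k. morse_tile n k \<sigma> T)"

definition tile_dim :: "'a::euclidean_space set \<Rightarrow> int" where
  "tile_dim T = aff_dim (underlying_simplex T)"

lemma morse_tile_closure:
  assumes "morse_tile n k \<sigma> T"
  shows "closure T = \<sigma>"
proof -
  from assms obtain F \<mu> where s: "int n simplex \<sigma>"
    and F: "F \<subseteq> {f. f face_of \<sigma> \<and> aff_dim f = int n - 1}"
    and mu: "\<mu> = {} \<or> \<mu> face_of \<sigma> \<and> aff_dim \<mu> < int n - 1"
    and T: "T = \<sigma> - (\<Union>F \<union> \<mu>)"
    unfolding morse_tile_def by blast
  have dim: "aff_dim \<sigma> = int n"
    using s by (simp add: aff_dim_simplex)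
  have cv: "convex \<sigma>" and cl: "closed \<sigma>"
    using s unfolding simplex
    by (auto simp: compact_imp_closed compact_convex_hull finite_imp_compact)
  have "f \<inter> rel_interior \<sigma> = {}" if "f face_of \<sigma>" "aff_dim f < int n" for f
  proof -
    have "f \<noteq> \<sigma>"
      using that(2) dim by auto
    then show ?thesis
      using face_of_disjoint_rel_interior[OF that(1)] by simp
  qed
  then have "\<Union>F \<inter> rel_interior \<sigma> = {}" "\<mu> \<inter> rel_interior \<sigma> = {}"
    using F mu by force+
  then have "rel_interior \<sigma> \<subseteq> T"
    using rel_interior_subset[of \<sigma>] unfolding T by blast
  moreover have "closure (rel_interior \<sigma>) = \<sigma>"
    using convex_closure_rel_interior[OF cv] closure_closed[OF cl] by simp
  moreover have "T \<subseteq> \<sigma>"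
    using T by blast
  ultimately show ?thesis
    using closure_minimal[OF _ cl] closure_mono[of "rel_interior \<sigma>" T] by blast
qed

lemma underlying_simplex_eq:
  assumes "morse_tile n k \<sigma> T"
  shows "underlying_simplex T = \<sigma>"
  unfolding underlying_simplex_def
  by (rule the_equality) (use assms morse_tile_closure in blast)+

lemma tile_dim_eq:
  assumes "morse_tile n k \<sigma> T"
  shows "tile_dim T = int n"
  using assms by (simp add: tile_dim_def underlying_simplex_eq morse_tile_def aff_dim_simplex)

definition morse_tiling ::
    "'a::euclidean_space set set \<Rightarrow> 'a set set \<Rightarrow> 'a set set \<Rightarrow> bool" where
  "morse_tiling K L \<T> \<longleftrightarrow>
     partition_on (relative_complex K L) \<T> \<and>
     (\<forall>T\<in>\<T>. is_morse_tile T \<and> underlying_simplex T \<in> K) \<and>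
     (\<forall>j::nat. closedin (top_of_set (relative_complex K L))
                (\<Union>{T \<in> \<T>. tile_dim T > int j}))"

definition shellable :: "'a::euclidean_space set \<Rightarrow> 'a set set \<Rightarrow> bool" where
  "shellable S \<T> \<longleftrightarrow>
     (\<exists>N A. A (0::nat) = {} \<and> A N = S \<and>
            (\<forall>j\<le>N. closedin (top_of_set S) (A j)) \<and>
            (\<forall>j\<in>{1..N}. A (j - 1) \<subseteq> A j \<and> A j - A (j - 1) \<in> \<T>))"

definition tiling_quiver ::
    "'a::euclidean_space set set \<Rightarrow> ('a set, 'a set \<times> 'a set) pre_digraph" where
  "tiling_quiver \<T> =
     \<lparr> verts = \<T>,
       arcs = {(T, T'). T \<in> \<T> \<and> T' \<in> \<T> \<and> T \<noteq> T' \<and> underlying_simplex T \<inter> T' \<noteq> {}},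
       tail = fst, head = snd \<rparr>"

definition oriented_cycle :: "('v, 'e) pre_digraph \<Rightarrow> 'e list \<Rightarrow> bool" where
  "oriented_cycle G p \<longleftrightarrow> (\<exists>u. pre_digraph.awalk G u p u) \<and> length p \<ge> 1"

end

theory Submission
  imports Defs
begin

(* An arrow T -> T' says exactly that T' meets the closure of T. A union of tiles is therefore closed
   in S iff it is closed under arrows, so a shelling is a linear order of the tiles in which
   every arrow decreases; such an order of a finite quiver exists iff the quiver is acyclic. *)

text \<open>The quiver's arrows, phrased through closures alone, so that shellability can be
  compared with acyclicity for any finite partition of a space, before simplices enter.\<close>

definition meets_closure :: "'a::topological_space set set \<Rightarrow> ('a set \<times> 'a set) set" where
  "meets_closure \<T> = {(T, T'). T \<in> \<T> \<and> T' \<in> \<T> \<and> T \<noteq> T' \<and> closure T \<inter> T' \<noteq> {}}"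

lemma acyclic_if_decreasing:
  fixes f :: "'b \<Rightarrow> nat"
  assumes "\<And>x y. (x, y) \<in> r \<Longrightarrow> f y < f x"
  shows "acyclic r"
proof -
  have "r\<inverse> \<subseteq> inv_image less_than f"
    using assms by auto
  then have "wf (r\<inverse>)"
    using wf_subset[OF wf_inv_image[OF wf_less_than]] by blast
  then show ?thesis
    using wf_acyclic acyclic_converse by blast
qed

text \<open>Number the tiles by the stage at which they are added. A closed stage containing T
  contains all of \<open>closure T\<close> that lies in S, so any other tile meeting
  \<open>closure T\<close> was added strictly earlier: numbers drop along arrows.\<close>

lemma shellable_imp_acyclic:
  assumes part: "partition_on S \<T>" and "shellable S \<T>"
  shows "acyclic (meets_closure \<T>)"
proof -
  obtain N A where A0: "A (0::nat) = {}" and AN: "A N = S"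
    and cl: "\<And>j. j \<le> N \<Longrightarrow> closedin (top_of_set S) (A j)"
    and step: "\<And>j. j \<in> {1..N} \<Longrightarrow> A (j - 1) \<subseteq> A j \<and> A j - A (j - 1) \<in> \<T>"
    using assms(2) unfolding shellable_def by blast
  \<comment> \<open>The first stage that merely meets T. Since each stage adds exactly one tile,
    \<open>tile\<close> below shows that all of T is added there.\<close>
  define idx where "idx T = (LEAST j. T \<inter> A j \<noteq> {})" for T
  have meets: "T \<inter> A N \<noteq> {}" if "T \<in> \<T>" for T
  proof -
    have "T \<noteq> {}" "T \<subseteq> S"
      using that part unfolding partition_on_def by auto
    then show ?thesis
      using AN by auto
  qed
  have idx_le: "idx T \<le> j" if "T \<inter> A j \<noteq> {}" for T j
    unfolding idx_def using that by (rule Least_le)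
  have idx_meets: "T \<inter> A (idx T) \<noteq> {}" if "T \<in> \<T>" for T
    unfolding idx_def using meets[OF that] by (rule LeastI)
  have tile: "T = A (idx T) - A (idx T - 1) \<and> idx T \<in> {1..N}" if T: "T \<in> \<T>" for T
  proof -
    \<comment> \<open>Stage 0 is empty, so the truncated difference \<open>idx T - 1\<close> is the
      true predecessor.\<close>
    have pos: "idx T \<noteq> 0"
      using idx_meets[OF T] A0 by (metis Int_empty_right)
    have range: "idx T \<in> {1..N}"
      using pos idx_le[OF meets[OF T]] by simp
    have "T \<inter> A (idx T - 1) = {}"
      using idx_le[of T "idx T - 1"] pos by fastforce
    then have "T \<inter> (A (idx T) - A (idx T - 1)) \<noteq> {}"
      using idx_meets[OF T] by blast
    then show ?thesis
      using step[OF range] T part range unfolding partition_on_def disjoint_def by metis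
  qed
  show ?thesis
  proof (rule acyclic_if_decreasing)
    fix T T' assume "(T, T') \<in> meets_closure \<T>"
    then have T: "T \<in> \<T>" and T': "T' \<in> \<T>" and ne: "T \<noteq> T'" and int: "closure T \<inter> T' \<noteq> {}"
      unfolding meets_closure_def by auto
    have "closedin (top_of_set S) (A (idx T))"
      using cl tile[OF T] by simp
    then obtain C where C: "closed C" "A (idx T) = S \<inter> C"
      unfolding closedin_closed by blast
    have "closure T \<subseteq> C"
      using tile[OF T] C by (intro closure_minimal) auto
    moreover have "T' \<subseteq> S"
      using T' part unfolding partition_on_def by blast
    ultimately have "T' \<inter> A (idx T) \<noteq> {}"
      using int C by blast
    then have "idx T' \<le> idx T"
      by (rule idx_le)
    moreover have "idx T' \<noteq> idx T"
      using tile[OF T] tile[OF T'] ne by metis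
    ultimately show "idx T' < idx T"
      by simp
  qed
qed

text \<open>Within S, \<open>closure T\<close> is covered by T and the targets of arrows from T.
  Hence the union of X is the trace on S of the closures of its members, and finitely many closures
  have a closed union.\<close>

lemma closedin_Union_if_arrow_closed:
  assumes "finite X" and "X \<subseteq> \<T>" and "\<Union>\<T> = S"
    and "meets_closure \<T> `` X \<subseteq> X"
  shows "closedin (top_of_set S) (\<Union>X)"
proof -
  have "S \<inter> closure T \<subseteq> \<Union>X" if "T \<in> X" for T
    using that assms(2-4) unfolding meets_closure_def by blast
  then have "\<Union>X = S \<inter> (\<Union>T\<in>X. closure T)"
    using assms(2,3) closure_subset by blast
  moreover have "closed (\<Union>T\<in>X. closure T)"
    using assms(1) by auto
  ultimately show ?thesis
    unfolding closedin_closed by blast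
qed

text \<open>Induction on the number of tiles: a tile of X that no arrow from X enters can be added
  last. Arbitrary arrow-closed X are allowed because the induction removes tiles; the case X =
  \<open>\<T>\<close> is a shelling.\<close>

lemma acyclic_imp_filtration:
  assumes part: "partition_on S \<T>" and "finite \<T>" and "acyclic (meets_closure \<T>)"
    and "X \<subseteq> \<T>" and "meets_closure \<T> `` X \<subseteq> X"
  shows "\<exists>N A. A (0::nat) = {} \<and> A N = \<Union>X \<and>
           (\<forall>j\<le>N. closedin (top_of_set S) (A j)) \<and>
           (\<forall>j\<in>{1..N}. A (j - 1) \<subseteq> A j \<and> A j - A (j - 1) \<in> \<T>)"
  using assms(4,5)
proof (induction "card X" arbitrary: X)
  case 0
  then have "X = {}"
    using \<open>finite \<T>\<close> finite_subset by fastforce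
  then show ?case
    by (intro exI[of _ 0] exI[of _ "\<lambda>_. {}"]) auto
next
  case (Suc n)
  have fin: "finite X"
    using Suc.prems \<open>finite \<T>\<close> finite_subset by blast
  have "finite (meets_closure \<T>)"
    by (rule finite_subset[of _ "\<T> \<times> \<T>"]) (use \<open>finite \<T>\<close> in \<open>auto simp: meets_closure_def\<close>)
  \<comment> \<open>A minimal element of X for this relation is a tile with no incoming arrow from
    X.\<close>
  then have "wf (meets_closure \<T>)"
    using assms(3) finite_acyclic_wf by blast
  moreover have "X \<noteq> {}"
    using Suc.hyps(2) by auto
  ultimately obtain T where T: "T \<in> X" and source: "\<And>Y. (Y, T) \<in> meets_closure \<T> \<Longrightarrow> Y \<notin> X"
    using wf_eq_minimal[of "meets_closure \<T>"] by blast
  have card: "n = card (X - {T})"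
    using Suc.hyps(2) T fin by simp
  have sub: "X - {T} \<subseteq> \<T>"
    using Suc.prems by blast
  \<comment> \<open>Arrows from the remaining tiles stay in X by hypothesis and miss T by
    \<open>source\<close>.\<close>
  have "meets_closure \<T> `` (X - {T}) \<subseteq> X - {T}"
    using Suc.prems source by blast
  from Suc.hyps(1)[OF card sub this] obtain N A where A: "A (0::nat) = {}" "A N = \<Union>(X - {T})"
      "\<forall>j\<le>N. closedin (top_of_set S) (A j)"
      "\<forall>j\<in>{1..N}. A (j - 1) \<subseteq> A j \<and> A j - A (j - 1) \<in> \<T>"
    by (elim exE conjE) (rule that)
  have closed: "closedin (top_of_set S) (\<Union>X)"
    using closedin_Union_if_arrow_closed[OF fin Suc.prems(1) _ Suc.prems(2)] part
    unfolding partition_on_def by blast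
  have "disjoint \<T>"
    using part unfolding partition_on_def by blast
  then have "T \<inter> \<Union>(X - {T}) = {}"
    using T Suc.prems(1) unfolding disjoint_def by blast
  then have last: "\<Union>(X - {T}) \<subseteq> \<Union>X" "\<Union>X - \<Union>(X - {T}) = T"
    using T by auto
  show ?case
  proof (intro exI conjI)
    let ?B = "A(Suc N := \<Union>X)"
    show "?B 0 = {}" "?B (Suc N) = \<Union>X"
      using A(1) by auto
    show "\<forall>j\<le>Suc N. closedin (top_of_set S) (?B j)"
      using A(3) closed by (auto simp: le_Suc_eq)
    show "\<forall>j\<in>{1..Suc N}. ?B (j - 1) \<subseteq> ?B j \<and> ?B j - ?B (j - 1) \<in> \<T>"
    proof
      fix j assume j: "j \<in> {1..Suc N}"
      show "?B (j - 1) \<subseteq> ?B j \<and> ?B j - ?B (j - 1) \<in> \<T>"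
      proof (cases "j = Suc N")
        case True
        then show ?thesis
          using last A(2) T Suc.prems(1) by auto
      next
        case False
        then have "j \<in> {1..N}" "?B (j - 1) = A (j - 1)" "?B j = A j"
          using j by auto
        then show ?thesis
          using A(4) by metis
      qed
    qed
  qed
qed

lemma shellable_iff_acyclic:
  assumes "partition_on S \<T>" and "finite \<T>"
  shows "shellable S \<T> \<longleftrightarrow> acyclic (meets_closure \<T>)"
proof
  show "shellable S \<T> \<Longrightarrow> acyclic (meets_closure \<T>)"
    using assms(1) by (rule shellable_imp_acyclic)
  assume "acyclic (meets_closure \<T>)"
  moreover have "meets_closure \<T> `` \<T> \<subseteq> \<T>"
    unfolding meets_closure_def by blast
  moreover have "\<Union>\<T> = S"
    using assms(1) unfolding partition_on_def by blast
  ultimately show "shellable S \<T>"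
    using acyclic_imp_filtration[OF assms, of \<T>] unfolding shellable_def by simp
qed

lemma underlying_simplex_eq_closure:
  "is_morse_tile T \<Longrightarrow> underlying_simplex T = closure T"
  unfolding is_morse_tile_def using morse_tile_closure underlying_simplex_eq by metis

text \<open>All removed faces have dimension below n, so they are proper and miss the relative
  interior.\<close>

lemma rel_interior_simplex_subset_morse_tile:
  assumes "morse_tile n k \<sigma> T"
  shows "rel_interior \<sigma> \<subseteq> T"
proof -
  from assms obtain F \<mu> where s: "int n simplex \<sigma>"
    and F: "F \<subseteq> {f. f face_of \<sigma> \<and> aff_dim f = int n - 1}"
    and mu: "\<mu> = {} \<or> \<mu> face_of \<sigma> \<and> aff_dim \<mu> < int n - 1"
    and T: "T = \<sigma> - (\<Union>F \<union> \<mu>)"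
    unfolding morse_tile_def by blast
  have "f \<inter> rel_interior \<sigma> = {}" if "f face_of \<sigma>" "aff_dim f < int n" for f
  proof -
    have "f \<noteq> \<sigma>"
      using that(2) aff_dim_simplex[OF s] by auto
    then show ?thesis
      using face_of_disjoint_rel_interior[OF that(1)] by simp
  qed
  then have "\<Union>F \<inter> rel_interior \<sigma> = {}" "\<mu> \<inter> rel_interior \<sigma> = {}"
    using F mu by force+
  then show ?thesis
    using rel_interior_subset[of \<sigma>] unfolding T by blast
qed

lemma rel_interior_closure_morse_tile:
  assumes "is_morse_tile T"
  shows "rel_interior (closure T) \<noteq> {}" and "rel_interior (closure T) \<subseteq> T"
proof -
  obtain n k \<sigma> where t: "morse_tile n k \<sigma> T"
    using assms unfolding is_morse_tile_def by blast
  have cl: "closure T = \<sigma>" and s: "int n simplex \<sigma>"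
    using t morse_tile_closure[OF t] by (auto simp: morse_tile_def)
  show "rel_interior (closure T) \<subseteq> T"
    using rel_interior_simplex_subset_morse_tile[OF t] cl by simp
  \<comment> \<open>Nonempty because the affine dimension n is at least 0, while that of the empty
    set is -1.\<close>
  have "convex \<sigma>" "\<sigma> \<noteq> {}"
    using s aff_dim_simplex[OF s] unfolding simplex by auto
  then show "rel_interior (closure T) \<noteq> {}"
    using cl by (simp add: rel_interior_eq_empty)
qed

text \<open>Taking closures embeds the tiling into the finite set K: tiles with equal closure share
  its nonempty relative interior, so by disjointness they coincide.\<close>

lemma finite_morse_tiling:
  assumes "finite K" and "morse_tiling K L \<T>"
  shows "finite \<T>"
proof (rule inj_on_finite)
  have tiles: "is_morse_tile T" "closure T \<in> K" if "T \<in> \<T>" for T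
    using that assms(2) underlying_simplex_eq_closure unfolding morse_tiling_def by metis+
  then show "closure ` \<T> \<subseteq> K"
    by blast
  have "disjoint \<T>"
    using assms(2) unfolding morse_tiling_def partition_on_def by blast
  show "inj_on closure \<T>"
  proof (rule inj_onI)
    fix T T' assume "T \<in> \<T>" "T' \<in> \<T>" "closure T = closure T'"
    moreover from this have "T \<inter> T' \<noteq> {}"
      using rel_interior_closure_morse_tile tiles by (metis Int_greatest subset_empty)
    ultimately show "T = T'"
      using \<open>disjoint \<T>\<close> unfolding disjoint_def by blast
  qed
qed (fact assms(1))

text \<open>Arcs are themselves pairs with projections as tail and head, so they equal their ends;
  for tiles, underlying simplex and closure agree.\<close>

lemma arcs_ends_tiling_quiver:
  assumes "\<And>T. T \<in> \<T> \<Longrightarrow> is_morse_tile T"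
  shows "arcs_ends (tiling_quiver \<T>) = meets_closure \<T>"
proof -
  have "arcs (tiling_quiver \<T>) = meets_closure \<T>"
    unfolding tiling_quiver_def meets_closure_def
    by (auto simp: assms underlying_simplex_eq_closure)
  then show ?thesis
    unfolding arcs_ends_conv by (simp add: tiling_quiver_def)
qed

text \<open>A nonempty closed walk at u exists exactly when (u, u) lies in the transitive closure of
  \<open>arcs_ends G\<close>.\<close>

lemma oriented_cycle_iff_not_acyclic:
  assumes "wf_digraph G"
  shows "(\<exists>p. oriented_cycle G p) \<longleftrightarrow> \<not> acyclic (arcs_ends G)"
proof -
  have "(\<exists>p. oriented_cycle G p) \<longleftrightarrow> (\<exists>u p. pre_digraph.awalk G u p u \<and> p \<noteq> [])"
    unfolding oriented_cycle_def by (auto simp: Suc_le_eq)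
  also have "\<dots> \<longleftrightarrow> \<not> acyclic (arcs_ends G)"
    unfolding wf_digraph.reachable1_awalk[OF assms, symmetric] acyclic_def by blast
  finally show ?thesis .
qed

theorem theorem1p1:
  fixes K L :: "'a::euclidean_space set set" and \<T> :: "'a set set"
  assumes "simplicial_complex K"
    and "simplicial_complex L" and "L \<subseteq> K"
    and "morse_tiling K L \<T>"
  shows "shellable (relative_complex K L) \<T> \<longleftrightarrow> \<not> (\<exists>p. oriented_cycle (tiling_quiver \<T>) p)"
proof -
  have part: "partition_on (relative_complex K L) \<T>"
    and tiles: "\<And>T. T \<in> \<T> \<Longrightarrow> is_morse_tile T"
    using assms(4) unfolding morse_tiling_def by auto
  have "finite \<T>"
    using finite_morse_tiling[OF _ assms(4)] assms(1) unfolding simplicial_complex_def by blast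
  moreover have "wf_digraph (tiling_quiver \<T>)"
    by unfold_locales (auto simp: tiling_quiver_def)
  ultimately show ?thesis
    by (simp add: shellable_iff_acyclic[OF part] oriented_cycle_iff_not_acyclic
        arcs_ends_tiling_quiver tiles)
qed

end
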